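(* Let $m\ge 1$ be an integer. For every $1\le i\le m$, the function $x\mapsto r_{i,m}(x)$ is strictly increasing on $[1,\infty)$. In addition, for every $0\le i<m$, the function $x\mapsto \frac{r_{m,m}(x)}{r_{i,m}(x)}$ is strictly increasing on $[1,\infty)$.
   Context: For an integer $n\ge 1$ and an integer $k$, let $\left(\!\binom{n}{k}\!\right)=\binom{n+k-1}{k}$ if $k\ge 0$ (so it is $1$ for $k=0$), and $\left(\!\binom{n}{k}\!\right)=0$ if $k<0$. For integers $m\ge 1$, $a\ge 1$, let $\Lambda_m(a)$ be the $(m+1)\times(m+1)$ matrix whose $(p,q)$ entry is $\left(\!\binom{a}{m+2-p-q}\!\right)$, $1\le p,q\le m+1$. Write $[a_1,a_2,\dots]$ for the simple continued fraction $a_1+\cfrac{1}{a_2+\cdots}$; for real $x\ge 1$ all $a_j$ are positive integers and $a_1=\lfloor x\rfloor$. For rational $x=[a_1,\dots,a_n]\ge 1$, let $M=\Lambda_m(a_1)\cdots\Lambda_m(a_n)$; the numbers $r_{i,m}(x)$, $0\le i\le m$, are defined by $$(r_{m,m}(x),r_{m-1,m}(x),\dots,r_{1,m}(x),r_{0,m}(x))^\top=\frac{1}{M_{m+1,1}}\,(\text{first column of }M),$$ so $r_{0,m}(x)=1$ (the two finite continued fraction expansions of a rational number give the same values). For irrational $x=[a_1,a_2,\dots]>1$ with convergents $x_n=[a_1,\dots,a_n]$, define $r_{i,m}(x)=\lim_{n\to\infty}r_{i,m}(x_n)$; this limit is known to exist. *)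

theory Defs
  imports Complex_Main "Jordan_Normal_Form.Matrix"
begin

definition multichoose :: "nat \<Rightarrow> int \<Rightarrow> nat" where
  "multichoose n k = (if k < 0 then 0 else (n + nat k - 1) choose nat k)"

(* Matrices are indexed from 0, so the entry with 1-based position (p, q), which is
   multichoose a (m + 2 - p - q), is found at (p - 1, q - 1). *)
definition Lambda_mat :: "nat \<Rightarrow> nat \<Rightarrow> real mat" where
  "Lambda_mat m a =
     mat (m + 1) (m + 1) (\<lambda>(p, q). real (multichoose a (int m - int p - int q)))"

definition Lambda_prod :: "nat \<Rightarrow> nat list \<Rightarrow> real mat" where
  "Lambda_prod m as = foldr (\<lambda>a M. Lambda_mat m a * M) as (1\<^sub>m (m + 1))"

(* The value at the empty list is a dummy; only nonempty lists are used below. *)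
fun cfrac :: "nat list \<Rightarrow> real" where
  "cfrac [] = 0"
| "cfrac [a] = real a"
| "cfrac (a # b # as) = real a + 1 / cfrac (b # as)"

definition is_cf_expansion :: "nat list \<Rightarrow> real \<Rightarrow> bool" where
  "is_cf_expansion as x \<longleftrightarrow> as \<noteq> [] \<and> (\<forall>a \<in> set as. a \<ge> 1) \<and> cfrac as = x"

(* The first column of M lists r_m, r_(m-1), ..., r_0 from top to bottom, up to
   normalisation by its last entry; hence r_i sits in row m - i (counted from 0). *)
definition r_of_list :: "nat \<Rightarrow> nat \<Rightarrow> nat list \<Rightarrow> real" where
  "r_of_list i m as = Lambda_prod m as $$ (m - i, 0) / Lambda_prod m as $$ (m, 0)"

(* A rational x > 1 has exactly two expansions, one ending in a + 1 and the other in
   a, 1; x = 1 has only [1].  Both give the same value, so the choice is immaterial. *)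
definition r_rat :: "nat \<Rightarrow> nat \<Rightarrow> real \<Rightarrow> real" where
  "r_rat i m x = r_of_list i m (SOME as. is_cf_expansion as x)"

(* Partial quotients are indexed from 0: cf_digit x 0 is the integer part of x. *)
definition complete_quotient :: "real \<Rightarrow> nat \<Rightarrow> real" where
  "complete_quotient x n = ((\<lambda>y. 1 / frac y) ^^ n) x"

definition cf_digit :: "real \<Rightarrow> nat \<Rightarrow> nat" where
  "cf_digit x n = nat \<lfloor>complete_quotient x n\<rfloor>"

definition cf_convergent :: "real \<Rightarrow> nat \<Rightarrow> real" where
  "cf_convergent x n = cfrac (map (cf_digit x) [0..<Suc n])"

(* Meaningful for x >= 1 and i <= m. *)
definition r_cf :: "nat \<Rightarrow> nat \<Rightarrow> real \<Rightarrow> real" where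
  "r_cf i m x = (if x \<in> \<rat> then r_rat i m x else lim (\<lambda>n. r_rat i m (cf_convergent x n)))"

end

theory Submission
  imports Defs
begin

text \<open>
  Put the first column of \<open>\<Lambda>\<^sub>m(a\<^sub>1) \<cdots> \<Lambda>\<^sub>m(a\<^sub>n)\<close> into a vector \<open>v\<^sub>0, \<dots>, v\<^sub>m\<close>, numbered from bottom
  to top, so that \<open>r\<^sub>i = v\<^sub>i / v\<^sub>0\<close>.  Prepending a partial quotient \<open>a\<close> reverses the vector and
  then multiplies it by the lower triangular Toeplitz matrix of the multichoose numbers of \<open>a\<close>.
  Both claims of the theorem are instances of a single one: for \<open>x < y\<close> every ratio \<open>r\<^sub>i / r\<^sub>j\<close>
  with \<open>j < i\<close> is smaller at \<open>x\<close> than at \<open>y\<close>.  That is, the vector of \<open>x\<close> is below that of \<open>y\<close>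
  in the monotone likelihood ratio order \<open>lr_less\<close>.

  This order fits the recursion.  Reversing the vectors reverses the order, and the
  Toeplitz matrix preserves it, because its two by two minors are nonnegative: the multichoose
  numbers of a fixed \<open>a\<close> are log-concave.  Hence prepending \<open>a\<close> reverses the order
  (\<open>cf_step_reverses_lr\<close>), exactly as \<open>t \<mapsto> a + 1 / t\<close> reverses the order of the reals.
  Expansions with different leading partial quotients \<open>a < b\<close> are compared through
  \<open>[a, 1] = [a + 1] \<le> [b]\<close>, where the two expansions of the same number have the same vector by the
  hockey stick identity.  This gives the claim for rationals (\<open>cf_le_if_cfrac_le\<close>), and in particular the
  independence of the chosen expansion.

  For irrational \<open>x\<close> the values at the convergents converge because two consecutive steps form a
  positive matrix whose entries agree up to a factor \<open>m + 1\<close> with those of a rank one matrix.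
  Such a matrix contracts the oscillation of the quotient of two vectors by a fixed
  factor, whatever the partial quotients are (\<open>two_cf_steps_contract\<close>), so vectors of expansions
  with a long common prefix are nearly proportional (\<open>cf_col_common_prefix\<close>).  The even convergents
  lie below \<open>x\<close> and the odd ones above, so monotonicity passes to the limit in its weak form; two
  rational numbers between \<open>x\<close> and \<open>y\<close> make it strict again (\<open>strict_mono_on_from_convergents\<close>).
\<close>

section \<open>Total positivity of the multichoose Toeplitz matrix\<close>

definition mc_kernel :: "nat \<Rightarrow> nat \<Rightarrow> nat \<Rightarrow> real" where
  "mc_kernel a i q = real (multichoose a (int i - int q))"

lemma mc_kernel_eq_binomial:
  "mc_kernel a i q = (if q \<le> i then real ((a + (i - q) - 1) choose (i - q)) else 0)"
proof (cases "q \<le> i")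
  case True
  hence "int i - int q = int (i - q)" by (simp add: of_nat_diff)
  thus ?thesis using True unfolding mc_kernel_def multichoose_def by (simp only: nat_int) simp
qed (simp add: mc_kernel_def multichoose_def)

lemma mc_kernel_shift: "q \<le> i \<Longrightarrow> mc_kernel a i q = mc_kernel a (i - q) 0"
  by (simp add: mc_kernel_eq_binomial)

lemma mc_kernel_above_diagonal: "i < q \<Longrightarrow> mc_kernel a i q = 0"
  by (simp add: mc_kernel_eq_binomial)

lemma mc_kernel_diagonal: "mc_kernel a i i = 1"
  by (simp add: mc_kernel_eq_binomial)

lemma mc_kernel_nonneg: "0 \<le> mc_kernel a i q"
  by (simp add: mc_kernel_def)

lemma mc_kernel_pos: "1 \<le> a \<Longrightarrow> q \<le> i \<Longrightarrow> 0 < mc_kernel a i q"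
  by (simp add: mc_kernel_eq_binomial)

lemma mc_kernel_rec:
  assumes "1 \<le> a"
  shows "mc_kernel a (Suc k) 0 = (real a + real k) / (real k + 1) * mc_kernel a k 0"
proof -
  have "Suc k * ((a + k) choose Suc k) = (a + k) * ((a + k - 1) choose k)"
    by (rule binomial_absorption)
  hence "real (Suc k) * real ((a + k) choose Suc k) = real (a + k) * real ((a + k - 1) choose k)"
    by (metis of_nat_mult)
  hence "(real k + 1) * mc_kernel a (Suc k) 0 = (real a + real k) * mc_kernel a k 0"
    unfolding mc_kernel_eq_binomial by (simp add: add.commute)
  thus ?thesis by (simp add: nonzero_eq_divide_eq mult.commute)
qed

lemma mc_kernel_mono_row: "1 \<le> a \<Longrightarrow> i \<le> j \<Longrightarrow> mc_kernel a i 0 \<le> mc_kernel a j 0"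
proof (rule lift_Suc_mono_le[of "\<lambda>k. mc_kernel a k 0" i j])
  fix k assume a: "1 \<le> a"
  have "1 * mc_kernel a k 0 \<le> (real a + real k) / (real k + 1) * mc_kernel a k 0"
    using a by (intro mult_right_mono mc_kernel_nonneg) simp
  thus "mc_kernel a k 0 \<le> mc_kernel a (Suc k) 0" unfolding mc_kernel_rec[OF a] by simp
qed

lemma mc_kernel_mono:
  assumes "1 \<le> a" "i \<le> j" shows "mc_kernel a i q \<le> mc_kernel a j q"
proof (cases "q \<le> i")
  case True
  thus ?thesis using assms mc_kernel_mono_row[of a "i - q" "j - q"]
    by (simp add: mc_kernel_shift[of q i] mc_kernel_shift[of q j])
qed (simp add: mc_kernel_above_diagonal mc_kernel_nonneg)

lemma mc_kernel_le_first_column: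
  assumes "1 \<le> a" shows "mc_kernel a i q \<le> mc_kernel a i 0"
proof (cases "q \<le> i")
  case True
  thus ?thesis using assms mc_kernel_mono_row[of a "i - q" i] by (simp only: mc_kernel_shift[of q i])
qed (simp add: mc_kernel_above_diagonal mc_kernel_nonneg)

text \<open>The quotient of consecutive entries of the first column is \<open>(a + k) / (k + 1)\<close>, which does not
  increase with \<open>k\<close> as \<open>a \<ge> 1\<close>.  Log-concavity is stated across gaps \<open>d\<close> and \<open>e\<close> because this is what a
  two by two minor of the Toeplitz matrix asks for.\<close>

lemma mc_kernel_log_concave:
  assumes a: "1 \<le> a"
  shows "mc_kernel a (l + d + e) 0 * mc_kernel a l 0 \<le> mc_kernel a (l + d) 0 * mc_kernel a (l + e) 0"
proof (induction d)
  case (Suc d)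
  let ?c = "\<lambda>k. (real a + real k) / (real k + 1)"
  have c: "?c (l + d + e) \<le> ?c (l + d)"
  proof -
    have "1 * real e \<le> real a * real e" using a by (intro mult_right_mono) auto
    thus ?thesis by (simp add: divide_simps) (simp add: algebra_simps)
  qed
  have "mc_kernel a (l + Suc d + e) 0 * mc_kernel a l 0
      = ?c (l + d + e) * (mc_kernel a (l + d + e) 0 * mc_kernel a l 0)"
    using mc_kernel_rec[OF a, of "l + d + e"] by simp
  also have "\<dots> \<le> ?c (l + d) * (mc_kernel a (l + d) 0 * mc_kernel a (l + e) 0)"
    using a by (intro mult_mono c Suc.IH mult_nonneg_nonneg mc_kernel_nonneg) auto
  also have "\<dots> = mc_kernel a (l + Suc d) 0 * mc_kernel a (l + e) 0"
    using mc_kernel_rec[OF a, of "l + d"] by simp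
  finally show ?case .
qed simp

lemma mc_kernel_minor_nonneg:
  assumes a: "1 \<le> a" and "j < i" "p < q"
  shows "mc_kernel a i p * mc_kernel a j q \<le> mc_kernel a i q * mc_kernel a j p"
proof (cases "q \<le> j")
  case True
  let ?l = "j - q" and ?d = "i - j" and ?e = "q - p"
  have eqs: "i - p = ?l + ?d + ?e" "i - q = ?l + ?d" "j - p = ?l + ?e"
    using True assms by auto
  have "mc_kernel a (i - p) 0 * mc_kernel a (j - q) 0 \<le> mc_kernel a (i - q) 0 * mc_kernel a (j - p) 0"
    unfolding eqs by (rule mc_kernel_log_concave[OF a])
  thus ?thesis using True assms
    mc_kernel_shift[of p i a] mc_kernel_shift[of q j a] mc_kernel_shift[of q i a] mc_kernel_shift[of p j a]
    by simp
qed (simp add: mc_kernel_above_diagonal mc_kernel_nonneg)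

text \<open>The source of the agreement between the two expansions \<open>[\<dots>, a, 1]\<close> and \<open>[\<dots>, a + 1]\<close> of a rational.\<close>

lemma mc_kernel_hockey_stick:
  assumes "1 \<le> a" "i \<le> m" shows "(\<Sum>q\<le>m. mc_kernel a i q) = mc_kernel (Suc a) i 0"
proof -
  have "(\<Sum>q\<le>m. mc_kernel a i q) = (\<Sum>q\<le>i. mc_kernel a i q)"
    using assms(2) by (intro sum.mono_neutral_right) (auto simp: mc_kernel_above_diagonal)
  also have "\<dots> = (\<Sum>k\<le>i. mc_kernel a k 0)"
    by (rule sum.reindex_bij_witness[of _ "\<lambda>k. i - k" "\<lambda>k. i - k"]) (auto simp: mc_kernel_shift[of _ i])
  also have "\<dots> = real (\<Sum>k\<le>i. (a - 1 + k) choose k)"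
    using assms(1) by (simp add: mc_kernel_eq_binomial)
  also have "\<dots> = mc_kernel (Suc a) i 0"
    using assms(1) by (simp only: sum_choose_lower) (simp add: mc_kernel_eq_binomial)
  finally show ?thesis .
qed

section \<open>First columns of the matrix products\<close>

text \<open>The action of one factor \<open>\<Lambda>\<^sub>m(a)\<close> on vectors numbered from bottom to top, so that index \<open>i\<close> is row
  \<open>m - i\<close>.  The renumbering makes visible the reversal \<open>v (m - q)\<close> followed by a lower triangular matrix.\<close>

definition cf_step :: "nat \<Rightarrow> nat \<Rightarrow> (nat \<Rightarrow> real) \<Rightarrow> nat \<Rightarrow> real" where
  "cf_step m a v i = (\<Sum>q\<le>m. mc_kernel a i q * v (m - q))"

text \<open>The matrix product applied to the first unit vector; in the numbering from bottom to top that vector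
  has its only nonzero entry at \<open>m\<close>.  It stands for the value \<open>\<infinity>\<close>, the empty continued fraction.\<close>

fun cf_col :: "nat \<Rightarrow> nat list \<Rightarrow> nat \<Rightarrow> real" where
  "cf_col m [] = (\<lambda>i. if i = m then 1 else 0)"
| "cf_col m (a # as) = cf_step m a (cf_col m as)"

lemma Lambda_prod_carrier: "Lambda_prod m as \<in> carrier_mat (m + 1) (m + 1)"
  by (induction as) (auto simp: Lambda_prod_def Lambda_mat_def)

lemma Lambda_prod_first_column:
  "i \<le> m \<Longrightarrow> Lambda_prod m as $$ (m - i, 0) = cf_col m as i"
proof (induction as arbitrary: i)
  case Nil
  thus ?case by (auto simp: Lambda_prod_def)
next
  case (Cons a as)
  have prod: "Lambda_prod m (a # as) = Lambda_mat m a * Lambda_prod m as"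
    by (simp add: Lambda_prod_def)
  have carrier: "Lambda_mat m a \<in> carrier_mat (m + 1) (m + 1)"
    by (simp add: Lambda_mat_def)
  have "Lambda_prod m (a # as) $$ (m - i, 0)
      = (\<Sum>q\<in>{0..<m + 1}. Lambda_mat m a $$ (m - i, q) * Lambda_prod m as $$ (q, 0))"
    unfolding prod using carrier Lambda_prod_carrier[of m as] Cons.prems
    by (auto simp: scalar_prod_def)
  also have "\<dots> = (\<Sum>q\<le>m. mc_kernel a i q * cf_col m as (m - q))"
  proof (rule sum.cong)
    fix q assume "q \<in> {..m}"
    hence q: "q \<le> m" by simp
    have "Lambda_mat m a $$ (m - i, q) = mc_kernel a i q"
      using q Cons.prems by (simp add: Lambda_mat_def mc_kernel_def of_nat_diff)
    moreover have "Lambda_prod m as $$ (q, 0) = cf_col m as (m - q)"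
      using Cons.IH[of "m - q"] q by simp
    ultimately show "Lambda_mat m a $$ (m - i, q) * Lambda_prod m as $$ (q, 0)
        = mc_kernel a i q * cf_col m as (m - q)" by simp
  qed auto
  finally show ?case by (simp add: cf_step_def)
qed

lemma r_of_list_eq_cf_col: "i \<le> m \<Longrightarrow> r_of_list i m as = cf_col m as i / cf_col m as 0"
  using Lambda_prod_first_column[of i m as] Lambda_prod_first_column[of 0 m as]
  by (simp add: r_of_list_def)

lemma cf_step_cong: "(\<And>i. i \<le> m \<Longrightarrow> v i = w i) \<Longrightarrow> cf_step m a v i = cf_step m a w i"
  by (simp add: cf_step_def)

lemma cf_step_nonneg: "(\<And>i. i \<le> m \<Longrightarrow> 0 \<le> v i) \<Longrightarrow> 0 \<le> cf_step m a v i"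
  unfolding cf_step_def by (intro sum_nonneg mult_nonneg_nonneg mc_kernel_nonneg) auto

lemma cf_step_lincomb:
  "cf_step m a (\<lambda>i. c * v i - d * w i) = (\<lambda>i. c * cf_step m a v i - d * cf_step m a w i)"
  unfolding cf_step_def sum_distrib_left sum_subtractf[symmetric]
  by (intro ext sum.cong refl) (simp add: algebra_simps)

lemma cf_step_ge_top:
  assumes "\<And>i. i \<le> m \<Longrightarrow> 0 \<le> v i"
  shows "mc_kernel a i 0 * v m \<le> cf_step m a v i"
proof -
  have "mc_kernel a i 0 * v (m - 0) \<le> (\<Sum>q\<le>m. mc_kernel a i q * v (m - q))"
    by (rule member_le_sum) (auto intro!: mult_nonneg_nonneg mc_kernel_nonneg assms)
  thus ?thesis by (simp add: cf_step_def)
qed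

lemma cf_step_mono_index:
  assumes "1 \<le> a" "\<And>i. i \<le> m \<Longrightarrow> 0 \<le> v i" "i \<le> j"
  shows "cf_step m a v i \<le> cf_step m a v j"
  unfolding cf_step_def using assms by (intro sum_mono mult_right_mono mc_kernel_mono) auto

lemma cf_col_nonneg: "0 \<le> cf_col m as i"
  by (induction as arbitrary: i) (auto intro: cf_step_nonneg)

lemma cf_step_pos:
  assumes "1 \<le> a" "\<And>i. i \<le> m \<Longrightarrow> 0 \<le> v i" "0 < v m"
  shows "0 < cf_step m a v i"
  using cf_step_ge_top[of m v a i] mc_kernel_pos[of a 0 i] assms
  by (meson le0 less_le_trans mult_pos_pos)

lemma cf_col_top_pos: "\<forall>a\<in>set as. 1 \<le> a \<Longrightarrow> 0 < cf_col m as m"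
  by (induction as) (auto intro: cf_step_pos cf_col_nonneg)

lemma cf_col_pos: "\<forall>a\<in>set as. 1 \<le> a \<Longrightarrow> as \<noteq> [] \<Longrightarrow> 0 < cf_col m as i"
  by (cases as) (auto intro!: cf_step_pos cf_col_nonneg cf_col_top_pos)

lemma cf_col_singleton: "cf_col m [a] i = mc_kernel a i 0"
proof -
  have "cf_col m [a] i = (\<Sum>q\<le>m. if q = 0 then mc_kernel a i q else 0)"
    unfolding cf_col.simps cf_step_def by (rule sum.cong) auto
  thus ?thesis by simp
qed

lemma cf_col_one: "cf_col m [1] i = 1"
  unfolding cf_col_singleton by (simp add: mc_kernel_eq_binomial)

lemma cf_col_final_one:
  assumes "1 \<le> a" "i \<le> m" shows "cf_col m [a, 1] i = cf_col m [Suc a] i"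
proof -
  have "cf_col m [a, 1] i = (\<Sum>q\<le>m. mc_kernel a i q)"
    using cf_col_one[of m] by (simp only: cf_col.simps(2)[of m a "[1]"] cf_step_def) simp
  thus ?thesis using mc_kernel_hockey_stick[OF assms] by (simp only: cf_col_singleton)
qed

section \<open>The likelihood ratio order\<close>

definition lr_less :: "nat \<Rightarrow> (nat \<Rightarrow> real) \<Rightarrow> (nat \<Rightarrow> real) \<Rightarrow> bool" where
  "lr_less m v w \<longleftrightarrow> (\<forall>i j. j < i \<and> i \<le> m \<longrightarrow> v i * w j < w i * v j)"

text \<open>The weakening of \<open>lr_less\<close> which still holds between a positive vector and the unit vector of the
  empty continued fraction: that vector vanishes below index \<open>m\<close>, so that only the ratios with numerator
  index \<open>m\<close> are strictly ordered.  One step turns it into the full strict order.\<close>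

definition lr_less_top :: "nat \<Rightarrow> (nat \<Rightarrow> real) \<Rightarrow> (nat \<Rightarrow> real) \<Rightarrow> bool" where
  "lr_less_top m v w \<longleftrightarrow>
     (\<forall>i j. j < i \<and> i \<le> m \<longrightarrow> v i * w j \<le> w i * v j) \<and> (\<forall>j<m. v m * w j < w m * v j)"

lemma lr_less_imp_top: "lr_less m v w \<Longrightarrow> lr_less_top m v w"
  unfolding lr_less_def lr_less_top_def by (auto intro: less_imp_le)

lemma lr_less_trans:
  assumes "lr_less m u v" "lr_less m v w"
    and u: "\<And>i. 0 < u i" and v: "\<And>i. 0 < v i" and w: "\<And>i. 0 < w i"
  shows "lr_less m u w"
  unfolding lr_less_def
proof (intro allI impI)
  fix i j assume ij: "j < i \<and> i \<le> m"
  have "u i * v j * w j < v i * u j * w j"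
    using assms(1) ij w by (auto simp: lr_less_def)
  also have "\<dots> = (v i * w j) * u j" by simp
  also have "\<dots> < (w i * v j) * u j"
    using assms(2) ij u by (auto simp: lr_less_def)
  finally have "v j * (u i * w j) < v j * (w i * u j)" by (simp add: mult_ac)
  thus "u i * w j < w i * u j" using v[of j] by simp
qed

text \<open>A case of the Cauchy-Binet formula: the two by two minor of the pair of image vectors is a sum of products of minors
  of the kernel with minors of the reversed vectors.  All products are nonnegative, and the one for the
  columns \<open>0\<close> and \<open>i\<close> is positive, which is the source of all strictness.\<close>

lemma cf_step_reverses_lr:
  assumes a: "1 \<le> a" and vw: "lr_less_top m v w"
  shows "lr_less m (cf_step m a w) (cf_step m a v)"
  unfolding lr_less_def
proof (intro allI impI)
  fix i j assume ij: "j < i \<and> i \<le> m"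
  define D where "D = (\<lambda>q p. v (m - q) * w (m - p) - w (m - q) * v (m - p))"
  define f where "f = (\<lambda>q p. mc_kernel a i q * mc_kernel a j p)"
  define A where "A = cf_step m a v i * cf_step m a w j - cf_step m a w i * cf_step m a v j"
  have A1: "A = (\<Sum>q\<le>m. \<Sum>p\<le>m. f q p * D q p)"
    unfolding A_def cf_step_def sum_product sum_subtractf[symmetric] D_def f_def
    by (intro sum.cong refl) (simp add: algebra_simps)
  \<comment> \<open>Antisymmetry of \<open>D\<close> turns twice the double sum into a sum of products of minors.\<close>
  have "A = (\<Sum>q\<le>m. \<Sum>p\<le>m. f p q * D p q)"
    unfolding A1 by (rule sum.swap)
  also have "\<dots> = (\<Sum>q\<le>m. \<Sum>p\<le>m. - (f p q * D q p))"
    by (intro sum.cong refl) (simp add: D_def algebra_simps)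
  finally have "A + A = (\<Sum>q\<le>m. \<Sum>p\<le>m. (f q p - f p q) * D q p)"
    using A1 by (simp add: sum_subtractf sum_negf left_diff_distrib)
  hence A2: "A + A = (\<Sum>x\<in>{..m} \<times> {..m}. (f (fst x) (snd x) - f (snd x) (fst x)) * D (fst x) (snd x))"
    by (simp add: sum.cartesian_product case_prod_beta)
  have below: "0 \<le> f q p - f p q" "0 \<le> D q p" if "p < q" "q \<le> m" for p q
  proof -
    show "0 \<le> f q p - f p q"
      using mc_kernel_minor_nonneg[OF a, of j i p q] ij that by (simp add: f_def)
    have "m - q < m - p \<and> m - p \<le> m" using that by auto
    hence "v (m - p) * w (m - q) \<le> w (m - p) * v (m - q)"
      using vw unfolding lr_less_top_def by blast
    thus "0 \<le> D q p" by (simp add: D_def mult.commute)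
  qed
  have nonneg: "0 \<le> (f q p - f p q) * D q p" if "p \<le> m" "q \<le> m" for p q
  proof (cases p q rule: linorder_cases)
    case less
    thus ?thesis using below that by auto
  next
    case equal
    thus ?thesis by simp
  next
    case greater
    have "(f q p - f p q) * D q p = (f p q - f q p) * D p q"
      by (simp add: D_def algebra_simps)
    thus ?thesis using below[of q p] greater that by auto
  qed
  have "0 < (f i 0 - f 0 i) * D i 0"
  proof (rule mult_pos_pos)
    show "0 < f i 0 - f 0 i"
      using ij a mc_kernel_pos[of a 0 j] by (simp add: f_def mc_kernel_above_diagonal mc_kernel_diagonal)
    show "0 < D i 0"
    proof -
      have "m - i < m" using ij by linarith
      hence "v m * w (m - i) < w m * v (m - i)" using vw unfolding lr_less_top_def by blast
      thus ?thesis by (simp add: D_def mult.commute)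
    qed
  qed
  hence "0 < (\<Sum>x\<in>{..m} \<times> {..m}. (f (fst x) (snd x) - f (snd x) (fst x)) * D (fst x) (snd x))"
    by (intro sum_pos2[of _ "(i, 0)"]) (use ij in \<open>auto intro: nonneg\<close>)
  hence "0 < A" using A2 by simp
  thus "cf_step m a w i * cf_step m a v j < cf_step m a v i * cf_step m a w j"
    by (simp add: A_def)
qed

lemma cf_col_lr_less_empty:
  assumes "\<forall>a\<in>set as. 1 \<le> a" "as \<noteq> []"
  shows "lr_less_top m (cf_col m as) (cf_col m [])"
  using cf_col_pos[OF assms] by (auto simp: lr_less_top_def less_imp_le)

section \<open>Comparison of finite continued fractions\<close>

lemma cfrac_Cons: "cfrac (a # as) = real a + 1 / cfrac as"
  by (cases as) auto

lemma cfrac_ge_1: "\<forall>a\<in>set as. 1 \<le> a \<Longrightarrow> as \<noteq> [] \<Longrightarrow> 1 \<le> cfrac as"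
proof (induction as)
  case (Cons a as)
  show ?case
  proof (cases "as = []")
    case False
    hence "0 \<le> 1 / cfrac as" using Cons by auto
    moreover have "1 \<le> real a" using Cons.prems by simp
    ultimately show ?thesis unfolding cfrac_Cons by linarith
  qed (use Cons in auto)
qed simp

lemma cfrac_inverse_bounds:
  assumes "\<forall>a\<in>set as. 1 \<le> a" shows "0 \<le> 1 / cfrac as" "1 / cfrac as \<le> 1"
  using cfrac_ge_1[OF assms] by (cases "as = []"; auto)+

text \<open>Comparison of values together with its consequence for the columns, so that chains of
  comparisons can be composed without tracking which links are strict.\<close>

definition cf_le :: "nat \<Rightarrow> nat list \<Rightarrow> nat list \<Rightarrow> bool" where
  "cf_le m as bs \<longleftrightarrow>
     cfrac as < cfrac bs \<and> lr_less m (cf_col m as) (cf_col m bs) \<or>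
     cfrac as = cfrac bs \<and> (\<forall>i\<le>m. cf_col m as i = cf_col m bs i)"

lemma cf_le_trans:
  assumes "cf_le m as bs" "cf_le m bs cs"
    and "\<forall>a\<in>set as. 1 \<le> a" "\<forall>a\<in>set bs. 1 \<le> a" "\<forall>a\<in>set cs. 1 \<le> a"
    and "as \<noteq> []" "bs \<noteq> []" "cs \<noteq> []"
  shows "cf_le m as cs"
proof -
  have t: "lr_less m (cf_col m as) (cf_col m cs)"
    if "lr_less m (cf_col m as) (cf_col m bs)" "lr_less m (cf_col m bs) (cf_col m cs)"
    using that by (rule lr_less_trans) (use assms cf_col_pos in auto)
  show ?thesis using assms(1,2) t unfolding cf_le_def lr_less_def by auto
qed

text \<open>The case \<open>as = []\<close> compares with the value \<open>\<infinity>\<close>, for which \<open>cfrac [] = 0\<close> is only a dummy that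
  makes \<open>1 / cfrac []\<close> come out right.\<close>

lemma cf_le_Cons:
  assumes "1 \<le> a" "\<forall>a\<in>set as. 1 \<le> a" "\<forall>a\<in>set bs. 1 \<le> a" "bs \<noteq> []"
    and "as = [] \<or> cf_le m bs as"
  shows "cf_le m (a # as) (a # bs)"
proof -
  have b: "0 < cfrac bs" using cfrac_ge_1[OF assms(3,4)] by simp
  show ?thesis
  proof (cases "as = []")
    case True
    thus ?thesis
      using b cf_step_reverses_lr[OF assms(1) cf_col_lr_less_empty[OF assms(3,4), of m]]
      by (simp add: cf_le_def cfrac_Cons)
  next
    case False
    hence a: "0 < cfrac as" using cfrac_ge_1[OF assms(2)] by simp
    from False assms(5) consider
      "cfrac bs < cfrac as" "lr_less m (cf_col m bs) (cf_col m as)"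
      | "cfrac bs = cfrac as" "\<forall>i\<le>m. cf_col m bs i = cf_col m as i"
      unfolding cf_le_def by blast
    thus ?thesis
    proof cases
      case 1
      have "1 / cfrac as < 1 / cfrac bs" using 1(1) a b by (simp add: field_simps)
      thus ?thesis
        using cf_step_reverses_lr[OF assms(1) lr_less_imp_top[OF 1(2)]]
        by (simp add: cf_le_def cfrac_Cons)
    next
      case 2
      thus ?thesis using cf_step_cong[of m "cf_col m bs" "cf_col m as"]
        by (simp add: cf_le_def cfrac_Cons)
    qed
  qed
qed

lemma cf_le_final_one: "1 \<le> a \<Longrightarrow> cf_le m [a, 1] [Suc a] \<and> cf_le m [Suc a] [a, 1]"
  using cf_col_final_one[of a _ m] by (simp add: cf_le_def del: cf_col.simps)

lemma cf_le_singleton: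
  assumes "1 \<le> a" "a \<le> b" shows "cf_le m [a] [b]"
  using assms(2)
proof (induction b rule: dec_induct)
  case base
  show ?case by (simp add: cf_le_def)
next
  case (step b)
  have "cf_le m [b] [b, 1]" using step assms(1) by (intro cf_le_Cons) auto
  with step.IH have "cf_le m [a] [b, 1]"
    by (rule cf_le_trans) (use step assms(1) in auto)
  moreover have "cf_le m [b, 1] [Suc b]" using cf_le_final_one step assms(1) by simp
  ultimately show ?case by (rule cf_le_trans) (use step assms(1) in auto)
qed

text \<open>For equal leading partial quotients the tails are compared in the opposite order.  For \<open>a < b\<close> the
  chain \<open>a # as' \<le> [a, 1] = [a + 1] \<le> [b] \<le> b # bs'\<close> applies; its first link compares \<open>as'\<close> with \<open>[1]\<close>,
  which is why the induction is on the total length.  A larger leading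
  partial quotient on the left is possible only for the two expansions of one number.\<close>

lemma cf_le_if_cfrac_le:
  assumes "\<forall>a\<in>set as. 1 \<le> a" "\<forall>a\<in>set bs. 1 \<le> a" "as \<noteq> []" "bs \<noteq> []" "cfrac as \<le> cfrac bs"
  shows "cf_le m as bs"
  using assms
proof (induction "length as + length bs" arbitrary: as bs rule: less_induct)
  case less
  obtain a as' where as: "as = a # as'" using less.prems by (cases as) auto
  obtain b bs' where bs: "bs = b # bs'" using less.prems by (cases bs) auto
  have dig: "1 \<le> a" "1 \<le> b" "\<forall>a\<in>set as'. 1 \<le> a" "\<forall>a\<in>set bs'. 1 \<le> a"
    using less.prems as bs by auto
  note ia = cfrac_inverse_bounds[OF dig(3)] and ib = cfrac_inverse_bounds[OF dig(4)]
  have le: "real a + 1 / cfrac as' \<le> real b + 1 / cfrac bs'"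
    using less.prems(5) by (simp add: as bs cfrac_Cons)
  have inv: "cfrac ys \<le> cfrac xs"
    if "1 / cfrac xs \<le> 1 / cfrac ys" "xs \<noteq> []" "ys \<noteq> []"
       "\<forall>a\<in>set xs. 1 \<le> a" "\<forall>a\<in>set ys. 1 \<le> a" for xs ys
    using that cfrac_ge_1[of xs] cfrac_ge_1[of ys] by (simp add: field_simps)
  have "a \<le> b \<or> (a = Suc b \<and> 1 / cfrac as' = 0 \<and> 1 / cfrac bs' = 1)"
  proof (cases "a \<le> b")
    case False
    hence "real a \<ge> real b + 1" by linarith
    hence "real a = real b + 1 \<and> 1 / cfrac as' = 0 \<and> 1 / cfrac bs' = 1"
      using le ia ib by linarith
    thus ?thesis by linarith
  qed simp
  then consider "a = b" | "a < b" | "a = Suc b" "1 / cfrac as' = 0" "1 / cfrac bs' = 1"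
    by linarith
  thus ?case
  proof cases
    case 1
    show ?thesis
    proof (cases "bs' = []")
      case True
      hence "as' = []" using le 1 ia cfrac_ge_1[OF dig(3)] by (cases "as' = []") (auto simp: field_simps)
      thus ?thesis using True 1 as bs by (simp add: cf_le_def)
    next
      case bs': False
      have "as' = [] \<or> cf_le m bs' as'"
      proof (cases "as' = []")
        case False
        have "cfrac bs' \<le> cfrac as'"
          by (rule inv) (use le 1 False bs' dig in auto)
        thus ?thesis using False bs' dig by (intro disjI2 less.hyps) (auto simp: as bs)
      qed simp
      thus ?thesis unfolding as bs 1 using dig bs' by (intro cf_le_Cons) auto
    qed
  next
    case 2
    have "as' = [] \<or> cf_le m [1] as'"
    proof (cases "as' = []")
      case False
      thus ?thesis using dig cfrac_ge_1[OF dig(3)]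
        by (intro disjI2 less.hyps) (auto simp: as bs)
    qed simp
    hence "cf_le m (a # as') [a, 1]" using dig by (intro cf_le_Cons) auto
    moreover have "cf_le m [a, 1] [Suc a]" using cf_le_final_one dig by simp
    ultimately have "cf_le m (a # as') [Suc a]"
      by (rule cf_le_trans) (use dig in auto)
    moreover have "cf_le m [Suc a] [b]" using 2 by (intro cf_le_singleton) auto
    ultimately have *: "cf_le m (a # as') [b]"
      by (rule cf_le_trans) (use dig in auto)
    show ?thesis
    proof (cases "bs' = []")
      case True
      thus ?thesis using * as bs by simp
    next
      case False
      hence "cf_le m [b] (b # bs')" using dig by (intro cf_le_Cons) auto
      with * show ?thesis unfolding as bs by (rule cf_le_trans) (use dig in auto)
    qed
  next
    case 3
    have as': "as' = []" using 3(2) cfrac_ge_1[OF dig(3)] by (cases "as' = []") auto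
    have bs': "bs' \<noteq> []" "cfrac bs' = 1" using 3(3) by auto
    have "cf_le m [Suc b] [b, 1]" using cf_le_final_one dig by simp
    moreover have "cf_le m bs' [1]"
      using bs' dig by (intro less.hyps) (auto simp: as bs as')
    hence "cf_le m [b, 1] (b # bs')" using dig bs' by (intro cf_le_Cons) auto
    ultimately show ?thesis unfolding as bs as' 3(1)
      by (rule cf_le_trans) (use dig in auto)
  qed
qed

section \<open>Contraction of two consecutive steps\<close>

text \<open>The product of two factors \<open>\<Lambda>\<^sub>m(a) \<Lambda>\<^sub>m(b)\<close> agrees with a rank one matrix up to the factor \<open>m + 1\<close>, which
  does not depend on \<open>a\<close> and \<open>b\<close>: both the weights in row \<open>i\<close> and the entries of the intermediate vector
  are largest in the summand \<open>q = 0\<close>, and there are \<open>m + 1\<close> summands.\<close>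

lemma two_cf_steps_bounds:
  assumes "1 \<le> a" "1 \<le> b" "\<And>i. i \<le> m \<Longrightarrow> 0 \<le> v i"
  shows "mc_kernel a i 0 * cf_step m b v m \<le> cf_step m a (cf_step m b v) i"
    and "cf_step m a (cf_step m b v) i \<le> (real m + 1) * (mc_kernel a i 0 * cf_step m b v m)"
proof -
  have nonneg: "0 \<le> cf_step m b v i" for i by (intro cf_step_nonneg assms)
  show "mc_kernel a i 0 * cf_step m b v m \<le> cf_step m a (cf_step m b v) i"
    by (intro cf_step_ge_top nonneg)
  have "cf_step m a (cf_step m b v) i \<le> real (card {..m}) * (mc_kernel a i 0 * cf_step m b v m)"
    unfolding cf_step_def[of m a]
    by (intro sum_bounded_above mult_mono mc_kernel_le_first_column cf_step_mono_index
        mc_kernel_nonneg nonneg assms) auto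
  thus "cf_step m a (cf_step m b v) i \<le> (real m + 1) * (mc_kernel a i 0 * cf_step m b v m)"
    by (simp add: add.commute)
qed

text \<open>Birkhoff's contraction argument.  The vectors \<open>v - l w\<close> and \<open>u w - v\<close> are nonnegative and add up to
  \<open>(u - l) w\<close>, so after the first of the two steps one of them has at least half of the top entry of
  the sum.  By the rank one bounds its image then dominates a fixed multiple of the image of \<open>w\<close>, which
  moves the corresponding bound \<open>l\<close> or \<open>u\<close> inwards.\<close>

lemma two_cf_steps_contract:
  fixes m a b :: nat and l u :: real
  defines "Q \<equiv> \<lambda>v. cf_step m a (cf_step m b v)"
  assumes ab: "1 \<le> a" "1 \<le> b" and w: "\<And>i. i \<le> m \<Longrightarrow> 0 \<le> w i"
    and lo: "\<And>i. i \<le> m \<Longrightarrow> l * w i \<le> v i" and up: "\<And>i. i \<le> m \<Longrightarrow> v i \<le> u * w i"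
    and lu: "l \<le> u"
  shows "\<exists>l' u'. l \<le> l' \<and> l' \<le> u' \<and> u' - l' \<le> (1 - 1 / (2 * (real m + 1))) * (u - l) \<and>
    (\<forall>i\<le>m. l' * Q w i \<le> Q v i \<and> Q v i \<le> u' * Q w i)"
proof -
  define C where "C = real m + 1"
  define \<delta> where "\<delta> = (u - l) / (2 * C)"
  define T where "T = (\<lambda>v. cf_step m b v m)"
  have C: "1 \<le> C" by (simp add: C_def)
  have \<delta>: "0 \<le> \<delta>" "\<delta> \<le> u - l"
    using lu C by (simp_all add: \<delta>_def divide_simps mult_le_cancel_left1)
  have eq: "(1 - 1 / (2 * (real m + 1))) * (u - l) = (u - l) - \<delta>"
    using C by (simp add: \<delta>_def C_def field_simps)
  have Q_lin: "Q (\<lambda>i. c * x i - d * y i) i = c * Q x i - d * Q y i" for c d x y i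
    by (simp add: Q_def cf_step_lincomb)
  have T_lin: "T (\<lambda>i. c * x i - d * y i) = c * T x - d * T y" for c d x y
    by (simp add: T_def cf_step_lincomb)
  have gain: "\<delta> * Q w i \<le> Q x i"
    if x: "\<And>i. i \<le> m \<Longrightarrow> 0 \<le> x i" and half: "(u - l) / 2 * T w \<le> T x" for x i
  proof -
    have "\<delta> * Q w i \<le> \<delta> * (C * (mc_kernel a i 0 * T w))"
      unfolding Q_def T_def C_def
      by (intro mult_left_mono two_cf_steps_bounds ab w \<delta>)
    also have "\<dots> = mc_kernel a i 0 * ((u - l) / 2 * T w)" using C by (simp add: \<delta>_def)
    also have "\<dots> \<le> mc_kernel a i 0 * T x" by (intro mult_left_mono half mc_kernel_nonneg)
    also have "\<dots> \<le> Q x i" unfolding Q_def T_def by (intro two_cf_steps_bounds ab x)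
    finally show ?thesis .
  qed
  define x where "x = (\<lambda>i. 1 * v i - l * w i)"
  define y where "y = (\<lambda>i. u * w i - 1 * v i)"
  have x: "0 \<le> x i" and y: "0 \<le> y i" if "i \<le> m" for i
    using lo[OF that] up[OF that] by (simp_all add: x_def y_def)
  have Qx: "Q x i = Q v i - l * Q w i" and Qy: "Q y i = u * Q w i - Q v i" for i
    unfolding x_def y_def Q_lin by simp_all
  have nonneg: "0 \<le> Q x i" "0 \<le> Q y i" for i
    unfolding Q_def by (intro cf_step_nonneg x y; assumption)+
  have "T x + T y = (u - l) * T w"
    by (simp only: x_def y_def T_lin) (simp add: algebra_simps)
  then consider "(u - l) / 2 * T w \<le> T x" | "(u - l) / 2 * T w \<le> T y"
    by (simp add: field_simps, linarith)
  thus ?thesis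
  proof cases
    case 1
    have "\<forall>i\<le>m. (l + \<delta>) * Q w i \<le> Q v i \<and> Q v i \<le> u * Q w i"
      using gain[OF x 1] nonneg(2) by (simp add: Qx Qy algebra_simps)
    thus ?thesis using \<delta> unfolding eq by (intro exI[of _ "l + \<delta>"] exI[of _ u]) auto
  next
    case 2
    have "\<forall>i\<le>m. l * Q w i \<le> Q v i \<and> Q v i \<le> (u - \<delta>) * Q w i"
      using gain[OF y 2] nonneg(1) by (simp add: Qx Qy algebra_simps)
    thus ?thesis using \<delta> unfolding eq by (intro exI[of _ l] exI[of _ "u - \<delta>"]) auto
  qed
qed

text \<open>The initial factor \<open>(m + 1)\<^sup>2\<close> bounds the quotient of the extreme ratios after two steps, however far
  from proportional the initial vectors were.\<close>

definition contraction :: "nat \<Rightarrow> nat \<Rightarrow> real" where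
  "contraction m n = (1 - 1 / (2 * (real m + 1))) ^ n * (real m + 1)\<^sup>2"

lemma contraction_nonneg: "0 \<le> contraction m n"
  by (simp add: contraction_def)

lemma contraction_tendsto_0: "contraction m \<longlonglongrightarrow> 0"
proof -
  have "(\<lambda>n. (1 - 1 / (2 * (real m + 1))) ^ n) \<longlonglongrightarrow> 0"
    by (rule LIMSEQ_realpow_zero) auto
  thus ?thesis using tendsto_mult_left_zero unfolding contraction_def by blast
qed

lemma cf_col_common_prefix:
  assumes "length ps = 2 * n + 2"
    and "\<forall>a\<in>set ps. 1 \<le> a" "\<forall>a\<in>set xs. 1 \<le> a" "\<forall>a\<in>set ys. 1 \<le> a"
  shows "\<exists>l u. 0 < l \<and> l \<le> u \<and> u - l \<le> contraction m n * l \<and>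
    (\<forall>i\<le>m. l * cf_col m (ps @ ys) i \<le> cf_col m (ps @ xs) i \<and>
           cf_col m (ps @ xs) i \<le> u * cf_col m (ps @ ys) i)"
  using assms(1,2)
proof (induction n arbitrary: ps)
  case 0
  then obtain a b where ps: "ps = [a, b]"
    by (metis add_0 length_0_conv length_Suc_conv mult_0_right numeral_2_eq_2)
  hence ab: "1 \<le> a" "1 \<le> b" using 0 by auto
  define C where "C = real m + 1"
  define s where "s = cf_step m b (cf_col m xs) m"
  define t where "t = cf_step m b (cf_col m ys) m"
  have C: "1 \<le> C" by (simp add: C_def)
  have st: "0 < s" "0 < t"
    unfolding s_def t_def by (intro cf_step_pos ab cf_col_nonneg cf_col_top_pos assms)+
  have X: "mc_kernel a i 0 * s \<le> cf_col m (ps @ xs) i" "cf_col m (ps @ xs) i \<le> C * (mc_kernel a i 0 * s)"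
    and Y: "mc_kernel a i 0 * t \<le> cf_col m (ps @ ys) i" "cf_col m (ps @ ys) i \<le> C * (mc_kernel a i 0 * t)" for i
    using two_cf_steps_bounds[OF ab, of m "cf_col m xs" i] two_cf_steps_bounds[OF ab, of m "cf_col m ys" i]
    by (auto simp: ps s_def t_def C_def cf_col_nonneg)
  let ?l = "s / (C * t)" and ?u = "C * s / t"
  have "0 < ?l" using st C by simp
  moreover have u: "?u = C\<^sup>2 * ?l" using C by (simp add: power2_eq_square)
  moreover have "1 * ?l \<le> C\<^sup>2 * ?l" using C st by (intro mult_right_mono) auto
  moreover have "?u - ?l \<le> contraction m 0 * ?l"
    using u \<open>0 < ?l\<close> by (simp add: contraction_def C_def)
  moreover have "?l * cf_col m (ps @ ys) i \<le> cf_col m (ps @ xs) i" for i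
  proof -
    have "?l * cf_col m (ps @ ys) i \<le> ?l * (C * (mc_kernel a i 0 * t))"
      using \<open>0 < ?l\<close> by (intro mult_left_mono Y) auto
    also have "\<dots> = mc_kernel a i 0 * s" using C st by simp
    finally show ?thesis using X(1) by (rule order_trans)
  qed
  moreover have "cf_col m (ps @ xs) i \<le> ?u * cf_col m (ps @ ys) i" for i
  proof -
    have "cf_col m (ps @ xs) i \<le> ?u * (mc_kernel a i 0 * t)" using X(2)[of i] C st by (simp add: mult_ac)
    also have "\<dots> \<le> ?u * cf_col m (ps @ ys) i" using C st by (intro mult_left_mono Y) auto
    finally show ?thesis .
  qed
  ultimately show ?case by (intro exI[of _ ?l] exI[of _ ?u]) auto
next
  case (Suc n)
  then obtain a b ps' where ps: "ps = a # b # ps'"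
    by (cases ps; cases "tl ps") auto
  hence ab: "1 \<le> a" "1 \<le> b" using Suc by auto
  have "length ps' = 2 * n + 2" "\<forall>a\<in>set ps'. 1 \<le> a" using Suc.prems ps by auto
  from Suc.IH[OF this] obtain l u where lu: "0 < l" "l \<le> u" "u - l \<le> contraction m n * l"
    "\<forall>i\<le>m. l * cf_col m (ps' @ ys) i \<le> cf_col m (ps' @ xs) i \<and>
           cf_col m (ps' @ xs) i \<le> u * cf_col m (ps' @ ys) i" by blast
  \<comment> \<open>The lower bound only grows, so the relative error shrinks along with the absolute one.\<close>
  obtain l' u' where *: "l \<le> l'" "l' \<le> u'" "u' - l' \<le> (1 - 1 / (2 * (real m + 1))) * (u - l)"
    "\<forall>i\<le>m. l' * cf_col m (ps @ ys) i \<le> cf_col m (ps @ xs) i \<and>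
           cf_col m (ps @ xs) i \<le> u' * cf_col m (ps @ ys) i"
    using two_cf_steps_contract[OF ab, of m "cf_col m (ps' @ ys)" l "cf_col m (ps' @ xs)" u]
      lu cf_col_nonneg ps by auto
  have "u' - l' \<le> (1 - 1 / (2 * (real m + 1))) * (contraction m n * l)"
    by (rule order_trans[OF *(3)], rule mult_left_mono[OF lu(3)]) simp
  also have "\<dots> = contraction m (Suc n) * l" by (simp add: contraction_def)
  also have "\<dots> \<le> contraction m (Suc n) * l'"
    by (intro mult_left_mono *(1) contraction_nonneg)
  finally show ?case using * lu(1) by (intro exI[of _ l'] exI[of _ u']) auto
qed

lemma r_of_list_ge_1:
  assumes "i \<le> m" "\<forall>a\<in>set as. 1 \<le> a" "as \<noteq> []" shows "1 \<le> r_of_list i m as"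
proof -
  obtain a as' where as: "as = a # as'" using assms(3) by (cases as) auto
  have "cf_col m as 0 \<le> cf_col m as i"
    unfolding as cf_col.simps by (intro cf_step_mono_index cf_col_nonneg) (use assms as in auto)
  thus ?thesis using cf_col_pos[OF assms(2,3), of m 0] assms(1) by (simp add: r_of_list_eq_cf_col)
qed

lemma r_of_list_common_prefix:
  assumes "length ps = 2 * n + 2" "i \<le> m"
    and "\<forall>a\<in>set ps. 1 \<le> a" "\<forall>a\<in>set xs. 1 \<le> a" "\<forall>a\<in>set ys. 1 \<le> a"
  shows "r_of_list i m (ps @ xs) - r_of_list i m (ps @ ys) \<le> contraction m n * r_of_list i m (ps @ ys)"
proof -
  let ?x = "cf_col m (ps @ xs)" and ?y = "cf_col m (ps @ ys)"
  obtain l u where lu: "0 < l" "l \<le> u" "u - l \<le> contraction m n * l"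
    "\<forall>i\<le>m. l * ?y i \<le> ?x i \<and> ?x i \<le> u * ?y i"
    using cf_col_common_prefix[OF assms(1,3,4,5)] by blast
  have pos: "0 < ?x j" "0 < ?y j" for j
    using assms by (auto intro!: cf_col_pos)
  have "?x i / ?x 0 \<le> (u * ?y i) / (l * ?y 0)"
    using lu assms(2) pos[of 0] pos[of i] by (intro frac_le mult_nonneg_nonneg mult_pos_pos) auto
  also have "\<dots> = u / l * (?y i / ?y 0)" by simp
  also have "\<dots> \<le> (1 + contraction m n) * (?y i / ?y 0)"
  proof (rule mult_right_mono)
    show "u / l \<le> 1 + contraction m n" using lu by (simp add: field_simps)
    show "0 \<le> ?y i / ?y 0" using pos by (simp add: less_imp_le)
  qed
  finally show ?thesis
    unfolding r_of_list_eq_cf_col[OF assms(2)] by (simp only: distrib_right mult_1)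
qed

section \<open>Rational arguments\<close>

lemma cfrac_in_Rats: "cfrac as \<in> \<rat>"
  by (induction as) (auto simp: cfrac_Cons)

text \<open>The Euclidean algorithm on \<open>p\<close> and \<open>q\<close>.\<close>

lemma ex_cf_expansion_fraction:
  "0 < q \<Longrightarrow> q \<le> p \<Longrightarrow> \<exists>as. is_cf_expansion as (real p / real q)"
proof (induction q arbitrary: p rule: less_induct)
  case (less q)
  have div: "real p / real q = real (p div q) + real (p mod q) / real q"
  proof -
    have "real p = real (p div q * q + p mod q)" by (simp only: div_mult_mod_eq)
    also have "\<dots> = real (p div q) * real q + real (p mod q)" by (simp only: of_nat_add of_nat_mult)
    finally show ?thesis using less.prems(1) by (simp add: divide_simps)
  qed
  have d1: "1 \<le> p div q" using less.prems by (simp add: Suc_le_eq div_greater_zero_iff)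
  show ?case
  proof (cases "p mod q = 0")
    case True
    thus ?thesis using d1 div by (intro exI[of _ "[p div q]"]) (simp add: is_cf_expansion_def)
  next
    case False
    obtain as where as: "is_cf_expansion as (real q / real (p mod q))"
      using less.IH[of "p mod q" q] False less.prems by auto
    hence "is_cf_expansion (p div q # as) (real p / real q)"
      using d1 unfolding is_cf_expansion_def by (simp add: cfrac_Cons div)
    thus ?thesis by blast
  qed
qed

lemma ex_cf_expansion:
  assumes "x \<in> \<rat>" "1 \<le> x" shows "\<exists>as. is_cf_expansion as x"
proof -
  obtain p q :: nat where pq: "q \<noteq> 0" "\<bar>x\<bar> = real p / real q" "coprime p q"
    using Rats_abs_nat_div_natE[OF assms(1)] by blast
  hence x: "x = real p / real q" using assms(2) by simp
  hence "real q \<le> real p" using assms(2) pq(1) by (simp add: le_divide_eq)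
  hence "q \<le> p" by simp
  thus ?thesis using ex_cf_expansion_fraction[of q p] pq(1) x by simp
qed

text \<open>Equal values are the boundary case of the comparison, so the choice of the expansion is immaterial.\<close>

lemma r_rat_eq_r_of_list:
  assumes "is_cf_expansion as x" "i \<le> m"
  shows "r_rat i m x = r_of_list i m as"
proof -
  let ?bs = "SOME as. is_cf_expansion as x"
  have bs: "is_cf_expansion ?bs x" using assms(1) by (rule someI)
  have "cf_le m as ?bs"
    using assms(1) bs by (intro cf_le_if_cfrac_le) (simp_all add: is_cf_expansion_def)
  thus ?thesis
    using assms bs by (auto simp: cf_le_def is_cf_expansion_def r_rat_def r_of_list_eq_cf_col)
qed

text \<open>Both are the ratios \<open>r\<^sub>k / r\<^sub>j\<close> with \<open>j < k\<close>: the first takes \<open>j = 0\<close>, the second \<open>k = m\<close>.\<close>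

lemma
  assumes "x \<in> \<rat>" "y \<in> \<rat>" "1 \<le> x" "x < y"
  shows r_rat_strict_mono: "1 \<le> i \<Longrightarrow> i \<le> m \<Longrightarrow> r_rat i m x < r_rat i m y"
    and r_rat_ratio_strict_mono:
      "i < m \<Longrightarrow> r_rat m m x / r_rat i m x < r_rat m m y / r_rat i m y"
proof -
  obtain as bs where as: "is_cf_expansion as x" and bs: "is_cf_expansion bs y"
    using ex_cf_expansion assms by fastforce
  have "cf_le m as bs"
    using as bs assms by (intro cf_le_if_cfrac_le) (simp_all add: is_cf_expansion_def)
  hence lr: "lr_less m (cf_col m as) (cf_col m bs)"
    using as bs assms by (simp add: cf_le_def is_cf_expansion_def)
  have pos: "0 < cf_col m as j" "0 < cf_col m bs j" for j
    using as bs by (auto simp: is_cf_expansion_def intro: cf_col_pos)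
  have r: "r_rat j m x = cf_col m as j / cf_col m as 0" "r_rat j m y = cf_col m bs j / cf_col m bs 0"
    if "j \<le> m" for j
    using that by (simp_all add: r_rat_eq_r_of_list[OF as] r_rat_eq_r_of_list[OF bs] r_of_list_eq_cf_col)
  have ratio: "cf_col m as k / cf_col m as j < cf_col m bs k / cf_col m bs j" if "j < k" "k \<le> m" for j k
    using lr that pos[of j] by (simp add: lr_less_def field_simps)
  show "r_rat i m x < r_rat i m y" if "1 \<le> i" "i \<le> m"
    using ratio[of 0 i] that by (simp add: r)
  show "r_rat m m x / r_rat i m x < r_rat m m y / r_rat i m y" if "i < m"
    using ratio[of i m] that pos[of 0] by (simp add: r)
qed

section \<open>Irrational arguments\<close>

lemma cf_digit_Suc: "cf_digit x (Suc n) = cf_digit (1 / frac x) n"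
  unfolding cf_digit_def complete_quotient_def by (simp add: funpow_Suc_right del: funpow.simps)

lemma cf_digits_Suc:
  "map (cf_digit x) [0..<Suc (Suc n)] = cf_digit x 0 # map (cf_digit (1 / frac x)) [0..<Suc n]"
proof -
  have "[0..<Suc (Suc n)] = 0 # map Suc [0..<Suc n]"
    unfolding map_Suc_upt by (rule upt_conv_Cons) simp
  thus ?thesis by (simp only: list.map map_map o_def cf_digit_Suc)
qed

lemma cf_convergent_Suc:
  "cf_convergent x (Suc n) = real (cf_digit x 0) + 1 / cf_convergent (1 / frac x) n"
  unfolding cf_convergent_def cf_digits_Suc cfrac_Cons ..

lemma irrational_inverse_frac:
  fixes x :: real
  assumes "x \<notin> \<rat>" shows "1 / frac x \<notin> \<rat>" "1 \<le> 1 / frac x"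
proof -
  have f: "frac x \<notin> \<rat>"
  proof
    assume "frac x \<in> \<rat>"
    hence "frac x + of_int \<lfloor>x\<rfloor> \<in> \<rat>" by (intro Rats_add) auto
    thus False using assms by (simp add: frac_def)
  qed
  have "frac x \<noteq> 0"
  proof
    assume "frac x = 0"
    thus False using f by (metis Rats_0)
  qed
  hence "0 < frac x" using frac_ge_0[of x] by linarith
  thus "1 \<le> 1 / frac x" using frac_lt_1[of x] by simp
  show "1 / frac x \<notin> \<rat>"
  proof
    assume "1 / frac x \<in> \<rat>"
    hence "1 / (1 / frac x) \<in> \<rat>" by (rule Rats_divide[OF Rats_1])
    thus False using f by (simp only: divide_divide_eq_right mult_1 div_by_1)
  qed
qed

lemma cf_digits_pos:
  assumes "x \<notin> \<rat>" "1 \<le> x" shows "1 \<le> cf_digit x n"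
  using assms
proof (induction n arbitrary: x)
  case 0
  thus ?case by (simp add: cf_digit_def complete_quotient_def le_nat_iff)
next
  case (Suc n)
  thus ?case using Suc.IH[OF irrational_inverse_frac[OF Suc.prems(1)]] by (simp add: cf_digit_Suc)
qed

lemma cf_convergent_expansion:
  assumes "x \<notin> \<rat>" "1 \<le> x"
  shows "is_cf_expansion (map (cf_digit x) [0..<Suc n]) (cf_convergent x n)"
  using cf_digits_pos[OF assms] by (auto simp: is_cf_expansion_def cf_convergent_def simp del: upt_Suc)

lemma cf_convergent_ge_1: "x \<notin> \<rat> \<Longrightarrow> 1 \<le> x \<Longrightarrow> 1 \<le> cf_convergent x n"
  using cf_convergent_expansion[of x n] cfrac_ge_1 unfolding is_cf_expansion_def by metis

text \<open>Passing to the complete quotient \<open>1 / frac x\<close> drops the first partial quotient, and \<open>t \<mapsto> a + 1 / t\<close> swaps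
  the two sides.\<close>

lemma cf_convergent_bracket:
  assumes "x \<notin> \<rat>" "1 \<le> x"
  shows "if even n then cf_convergent x n \<le> x else x \<le> cf_convergent x n"
  using assms
proof (induction n arbitrary: x)
  case 0
  thus ?case by (simp add: cf_convergent_def cf_digit_def complete_quotient_def)
next
  case (Suc n)
  define y where "y = 1 / frac x"
  have y: "y \<notin> \<rat>" "1 \<le> y"
    unfolding y_def by (rule irrational_inverse_frac[OF Suc.prems(1)])+
  have x: "x = real (cf_digit x 0) + 1 / y"
    using Suc.prems(2) by (simp add: y_def cf_digit_def complete_quotient_def frac_def)
  have conv: "cf_convergent x (Suc n) = real (cf_digit x 0) + 1 / cf_convergent y n"
    by (simp only: cf_convergent_Suc y_def)
  have pos: "1 \<le> cf_convergent y n" by (rule cf_convergent_ge_1[OF y])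
  show ?case
  proof (cases "even n")
    case True
    hence "1 / y \<le> 1 / cf_convergent y n"
      using Suc.IH[OF y] pos y(2) by (intro divide_left_mono mult_pos_pos) auto
    thus ?thesis using True x conv by simp
  next
    case False
    hence "1 / cf_convergent y n \<le> 1 / y"
      using Suc.IH[OF y] pos y(2) by (intro divide_left_mono mult_pos_pos) auto
    thus ?thesis using False x conv by simp
  qed
qed

lemma r_cf_rational: "x \<in> \<rat> \<Longrightarrow> r_cf i m x = r_rat i m x"
  by (simp add: r_cf_def)

text \<open>The values form a Cauchy sequence because later convergents share long prefixes of partial
  quotients.  The lower bound keeps quotients of limits well behaved.\<close>

lemma r_rat_convergent_tendsto:
  assumes x: "x \<notin> \<rat>" "1 \<le> x" and i: "i \<le> m"
  shows "(\<lambda>n. r_rat i m (cf_convergent x n)) \<longlonglongrightarrow> r_cf i m x"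
    and "1 \<le> r_cf i m x"
proof -
  define ds where "ds = (\<lambda>n. map (cf_digit x) [0..<Suc n])"
  define r where "r = (\<lambda>n. r_of_list i m (ds n))"
  have r_eq: "r_rat i m (cf_convergent x n) = r n" for n
    unfolding r_def ds_def by (rule r_rat_eq_r_of_list[OF cf_convergent_expansion[OF x] i])
  have ge1: "1 \<le> r n" for n
    unfolding r_def ds_def using cf_digits_pos[OF x] i by (intro r_of_list_ge_1) auto
  have close: "r k - r l \<le> contraction m N * r l" if "2 * N + 1 \<le> k" "2 * N + 1 \<le> l" for N k l
  proof -
    define ps where "ps = map (cf_digit x) [0..<2 * N + 2]"
    have split: "ds n = ps @ map (cf_digit x) [2 * N + 2..<Suc n]" if "2 * N + 1 \<le> n" for n
      unfolding ds_def ps_def map_append[symmetric]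
      using upt_add_eq_append[of 0 "2 * N + 2" "n - (2 * N + 1)"] that by simp
    show ?thesis unfolding r_def split[OF that(1)] split[OF that(2)]
      using cf_digits_pos[OF x] i by (intro r_of_list_common_prefix) (auto simp: ps_def)
  qed
  \<comment> \<open>The relative error bound for prefixes of length two yields a uniform bound on the values.\<close>
  define B where "B = (1 + contraction m 0) * r 1"
  have B: "r k \<le> B" if "1 \<le> k" for k
    using close[of 0 k 1] that by (simp add: B_def algebra_simps)
  have "Cauchy r"
  proof (rule metric_CauchyI)
    fix e :: real assume "0 < e"
    have "(\<lambda>N. contraction m N * B) \<longlonglongrightarrow> 0"
      using tendsto_mult_left_zero[OF contraction_tendsto_0] .
    hence "\<forall>\<^sub>F N in sequentially. contraction m N * B < e"
      using \<open>0 < e\<close> by (rule order_tendstoD(2))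
    then obtain N where N: "contraction m N * B < e" by (auto simp: eventually_sequentially)
    have *: "r k - r l < e" if "2 * N + 1 \<le> k" "2 * N + 1 \<le> l" for k l
    proof -
      have "contraction m N * r l \<le> contraction m N * B"
        using that by (intro mult_left_mono B contraction_nonneg) auto
      thus ?thesis using close[OF that] N by linarith
    qed
    show "\<exists>M. \<forall>k\<ge>M. \<forall>l\<ge>M. dist (r k) (r l) < e"
      using * by (intro exI[of _ "2 * N + 1"]) (auto simp: dist_real_def abs_less_iff)
  qed
  hence "r \<longlonglongrightarrow> lim r"
    by (simp add: Cauchy_convergent_iff convergent_LIMSEQ_iff)
  moreover have "r_cf i m x = lim r" using x by (simp add: r_cf_def r_eq)
  ultimately show lim: "(\<lambda>n. r_rat i m (cf_convergent x n)) \<longlonglongrightarrow> r_cf i m x"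
    by (simp add: r_eq)
  show "1 \<le> r_cf i m x"
    using lim by (rule LIMSEQ_le_const) (auto simp: r_eq ge1)
qed

section \<open>From rational to real arguments\<close>

text \<open>Infinitely many convergents on each side of an irrational \<open>x\<close> suffice to compare the limit with the
  values at rationals.  Two rationals \<open>p < q\<close> strictly
  between \<open>x\<close> and \<open>y\<close> recover the strict inequality lost in the limits.\<close>

lemma strict_mono_on_from_convergents:
  fixes f F :: "real \<Rightarrow> real"
  assumes mono: "\<And>x y. x \<in> \<rat> \<Longrightarrow> y \<in> \<rat> \<Longrightarrow> 1 \<le> x \<Longrightarrow> x < y \<Longrightarrow> f x < f y"
    and rat: "\<And>x. x \<in> \<rat> \<Longrightarrow> F x = f x"
    and irr: "\<And>x. x \<notin> \<rat> \<Longrightarrow> 1 \<le> x \<Longrightarrow> (\<lambda>n. f (cf_convergent x n)) \<longlonglongrightarrow> F x"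
  shows "strict_mono_on {1..} F"
proof (rule strict_mono_onI)
  have conv_rat: "cf_convergent x n \<in> \<rat>" for x n
    unfolding cf_convergent_def by (rule cfrac_in_Rats)
  have weak: "f x \<le> f y" if "x \<in> \<rat>" "y \<in> \<rat>" "1 \<le> x" "x \<le> y" for x y
    using mono[of x y] that by (cases "x = y") auto
  have le: "F x \<le> f q" if "1 \<le> x" "q \<in> \<rat>" "x < q" for x q
  proof (cases "x \<in> \<rat>")
    case True
    thus ?thesis using mono[of x q] rat[of x] that by simp
  next
    case False
    have "(\<lambda>k. f (cf_convergent x (2 * k))) \<longlonglongrightarrow> F x"
      using LIMSEQ_subseq_LIMSEQ[OF irr[OF False that(1)], of "\<lambda>k. 2 * k"]
      by (simp add: strict_mono_def o_def)
    moreover have "f (cf_convergent x (2 * k)) \<le> f q" for k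
      using cf_convergent_bracket[OF False that(1), of "2 * k"]
        cf_convergent_ge_1[OF False that(1), of "2 * k"] that
      by (intro weak conv_rat) auto
    ultimately show ?thesis by (intro LIMSEQ_le_const2) auto
  qed
  have ge: "f q \<le> F x" if "1 \<le> q" "q \<in> \<rat>" "q < x" for x q
  proof (cases "x \<in> \<rat>")
    case True
    thus ?thesis using mono[of q x] rat[of x] that by simp
  next
    case False
    have x: "1 \<le> x" using that by simp
    have "(\<lambda>k. f (cf_convergent x (2 * k + 1))) \<longlonglongrightarrow> F x"
      using LIMSEQ_subseq_LIMSEQ[OF irr[OF False x], of "\<lambda>k. 2 * k + 1"]
      by (simp add: strict_mono_def o_def)
    moreover have "f q \<le> f (cf_convergent x (2 * k + 1))" for k
      using cf_convergent_bracket[OF False x, of "2 * k + 1"] that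
      by (intro weak conv_rat) auto
    ultimately show ?thesis by (intro LIMSEQ_le_const) auto
  qed
  fix x y :: real assume xy: "x \<in> {1..}" "y \<in> {1..}" "x < y"
  obtain p where p: "p \<in> \<rat>" "x < p" "p < y" using Rats_dense_in_real[OF xy(3)] by blast
  obtain q where q: "q \<in> \<rat>" "p < q" "q < y" using Rats_dense_in_real[OF p(3)] by blast
  have "F x \<le> f p" using xy p by (intro le) auto
  also have "f p < f q" using xy p q by (intro mono) auto
  also have "f q \<le> F y" using xy p q by (intro ge) auto
  finally show "F x < F y" .
qed

theorem theorem2:
  fixes m :: nat
  assumes "m \<ge> 1"
  shows "(\<forall>i. 1 \<le> i \<and> i \<le> m \<longrightarrow> strict_mono_on {1..} (\<lambda>x::real. r_cf i m x)) \<and>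
         (\<forall>i. i < m \<longrightarrow> strict_mono_on {1..} (\<lambda>x::real. r_cf m m x / r_cf i m x))"
proof (intro conjI allI impI)
  fix i assume i: "1 \<le> i \<and> i \<le> m"
  show "strict_mono_on {1..} (\<lambda>x::real. r_cf i m x)"
    by (rule strict_mono_on_from_convergents[of "r_rat i m"])
       (use i in \<open>auto intro: r_rat_strict_mono r_rat_convergent_tendsto simp: r_cf_rational\<close>)
next
  fix i assume i: "i < m"
  show "strict_mono_on {1..} (\<lambda>x::real. r_cf m m x / r_cf i m x)"
  proof (rule strict_mono_on_from_convergents[of "\<lambda>x. r_rat m m x / r_rat i m x"])
    fix x :: real assume x: "x \<notin> \<rat>" "1 \<le> x"
    show "(\<lambda>n. r_rat m m (cf_convergent x n) / r_rat i m (cf_convergent x n))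
        \<longlonglongrightarrow> r_cf m m x / r_cf i m x"
      using r_rat_convergent_tendsto[OF x, of m m] r_rat_convergent_tendsto[OF x, of i m] i
      by (intro tendsto_divide) auto
  qed (use i in \<open>auto intro: r_rat_ratio_strict_mono simp: r_cf_rational\<close>)
qed

end
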